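(* Let $k,m\ge 1$ be integers. There exist matrices $E$ and $F$ and a vector $g$ such that the linear system $Ey+Fw=g,\ w\geq 0$ (in variables $y\in\mathbb{R}^m$ and an additional vector of real variables $w$) has $\mathcal{O}(k^2m)$ variables and constraints, and the projection of its solution set onto the $y$-space is equal to $\mathrm{conv}(Y_{k,m})$.
   Context: $L_{k,m}$ denotes the set of $k\times m$ binary matrices $z=[z_1,\ldots,z_k]^\top$ whose rows $z_1^\top,\ldots,z_k^\top$, with $z_i\in\{0,1\}^m$, are in (strictly) increasing lexicographical order, i.e. $z_i\prec z_j$ for all $i<j$, where $\prec$ is the usual (strict) lexicographical order on $\{0,1\}^m$; in particular the rows are pairwise distinct. Define $$Y_{k,m}:=\Big\{y\in\mathbb{Z}_+^m:\ y=\sum_{i=1}^k z_i\ \text{for some}\ [z_1,\ldots,z_k]^\top\in L_{k,m}\Big\}.$$ $\mathrm{conv}$ denotes the convex hull in $\mathbb{R}^m$ (with $\mathrm{conv}(\emptyset)=\emptyset$). The constant hidden in $\mathcal{O}(k^2m)$ is absolute (independent of $k$ and $m$). *)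

theory Defs
  imports Complex_Main "Jordan_Normal_Form.Matrix"
begin

definition L :: "nat \<Rightarrow> nat \<Rightarrow> nat mat set" where
  "L k m = {Z \<in> carrier_mat k m.
     (\<forall>i<k. \<forall>j<m. Z $$ (i, j) \<in> {0, 1}) \<and>
     (\<forall>i j. i < j \<and> j < k \<longrightarrow>
        (list_of_vec (row Z i), list_of_vec (row Z j)) \<in> lexord less_than)}"

definition Y :: "nat \<Rightarrow> nat \<Rightarrow> nat vec set" where
  "Y k m = {y \<in> carrier_vec m. \<exists>Z \<in> L k m. \<forall>j<m. y $ j = (\<Sum>i<k. row Z i $ j)}"

text \<open>
  Since the dimension of \<^typ>\<open>real vec\<close> is not part of the type, \<^typ>\<open>real vec\<close> is not a
  \<^class>\<open>real_vector\<close>, and the convex hull of the library does not apply.  The following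
  is its definition relative to the carrier of dimension \<open>m\<close>.
\<close>

definition convex_vec :: "nat \<Rightarrow> real vec set \<Rightarrow> bool" where
  "convex_vec m S \<longleftrightarrow> S \<subseteq> carrier_vec m \<and>
     (\<forall>x\<in>S. \<forall>y\<in>S. \<forall>u\<ge>0. \<forall>v\<ge>0. u + v = 1 \<longrightarrow> u \<cdot>\<^sub>v x + v \<cdot>\<^sub>v y \<in> S)"

definition conv :: "nat \<Rightarrow> real vec set \<Rightarrow> real vec set" where
  "conv m S = convex_vec m hull S"

end

theory Submission
  imports Defs "HOL-Library.List_Lexorder"
begin

text \<open>
  Up to order, an element of \<open>L k m\<close> is a set of \<open>k\<close> distinct binary rows, that is, a family of \<open>k\<close>
  subsets of \<open>{..<m}\<close>, and its column sums are the degrees of the family (\<open>Y_iff_family\<close>). A family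
  of \<open>j\<close> subsets of \<open>{..n}\<close> is a pair of families of subsets of \<open>{..<n}\<close>: the members without \<open>n\<close> and
  those with \<open>n\<close>, the latter with \<open>n\<close> removed. If their sizes are \<open>a\<close> and \<open>b\<close>, then \<open>a + b = j\<close>, the
  degree of \<open>n\<close> is \<open>b\<close>, and the other degrees are the sums of those of the two parts. The parts are
  arbitrary and independent of each other, so only their sizes matter for how to go on. This is a
  dynamic program with the states (level, size) in which every decision leads to two states.

  Its decisions, taken with fractional multiplicities \<open>x r a b\<close> and balanced at each state, are the
  flows in a directed hypergraph with about \<open>k\<^sup>2 m\<close> hyperarcs and about \<open>k m\<close> nodes. The degrees are
  linear in \<open>x\<close>, which gives a linear system of the required size (\<open>flow_polytope_as_system\<close>).
  A single family is an integral flow (\<open>flow_of_family\<close>), so the projection of the flows contains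
  the convex hull of \<open>Y k m\<close>. Conversely each flow is a nonnegative combination of families with
  the same degrees (\<open>flow_decomposition\<close>). By induction the flows below the top level are such
  combinations; after normalization they are, for each size, a probability distribution on the
  families of that size. Drawing the two parts of each top split independently from these
  distributions yields the weights on the next level. So the projection is exactly the convex hull
  (\<open>flow_polytope_eq_conv\<close>).
\<close>

section \<open>Families of sets instead of ordered binary matrices\<close>

text \<open>
  A set of distinct binary rows of length \<open>n\<close> is treated as a family of subsets of \<open>{..<n}\<close>, a row
  being identified with its support; the column sums are then the degrees of the family.
\<close>
definition deg :: "nat \<Rightarrow> nat set set \<Rightarrow> nat" where
  "deg c A = card {S \<in> A. c \<in> S}"

definition families :: "nat \<Rightarrow> nat set set set" where
  "families n = Pow (Pow {..<n})"

lemma finite_families [simp]: "finite (families n)"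
  by (simp add: families_def)

lemma finite_family: "A \<in> families n \<Longrightarrow> finite A"
  by (metis families_def PowD finite_Pow_iff finite_lessThan finite_subset)

text \<open>
  Reversal of the split of a family according to whether its members contain the new element
  \<open>n\<close>. This is the recursion that the whole proof follows.
\<close>
definition glue :: "nat \<Rightarrow> nat set set \<Rightarrow> nat set set \<Rightarrow> nat set set" where
  "glue n P Q = P \<union> insert n ` Q"

lemma inj_on_insert_new: "Q \<in> families n \<Longrightarrow> inj_on (insert n) Q"
  by (rule inj_onI, subst (asm) insert_ident) (auto simp: families_def)

lemma card_deg_glue:
  assumes "P \<in> families n" "Q \<in> families n"
  shows card_glue: "card (glue n P Q) = card P + card Q"
    and deg_glue_old: "c < n \<Longrightarrow> deg c (glue n P Q) = deg c P + deg c Q"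
    and deg_glue_new: "deg n (glue n P Q) = card Q"
proof -
  have notin: "S \<in> P \<union> Q \<Longrightarrow> n \<notin> S" for S
    using assms by (auto simp: families_def)
  note fin = finite_family[OF assms(1)] finite_family[OF assms(2)]
  have inj: "inj_on (insert n) R" if "R \<subseteq> Q" for R
    using inj_on_insert_new[OF assms(2)] that by (rule inj_on_subset)
  have union: "card (P' \<union> insert n ` Q') = card P' + card Q'" if "P' \<subseteq> P" "Q' \<subseteq> Q" for P' Q'
  proof -
    have "card (P' \<union> insert n ` Q') = card P' + card (insert n ` Q')"
      using that notin fin by (intro card_Un_disjoint) (auto intro: finite_subset)
    then show ?thesis using card_image[OF inj[OF that(2)]] by simp
  qed
  show "card (glue n P Q) = card P + card Q"
    unfolding glue_def by (rule union) auto
  show "deg n (glue n P Q) = card Q"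
  proof -
    have "{S \<in> glue n P Q. n \<in> S} = {} \<union> insert n ` Q"
      using notin by (auto simp: glue_def)
    then show ?thesis unfolding deg_def by (simp add: card_image[OF inj])
  qed
  show "deg c (glue n P Q) = deg c P + deg c Q" if "c < n"
  proof -
    have "{S \<in> glue n P Q. c \<in> S} = {S \<in> P. c \<in> S} \<union> insert n ` {S \<in> Q. c \<in> S}"
      using that by (auto simp: glue_def)
    then show ?thesis unfolding deg_def by (simp add: union)
  qed
qed

lemma bij_betw_glue:
  "bij_betw (\<lambda>(P, Q). glue n P Q) (families n \<times> families n) (families (Suc n))"
proof (rule bij_betw_byWitness[where f' = "\<lambda>A. ({S \<in> A. n \<notin> S}, (\<lambda>S. S - {n}) ` {S \<in> A. n \<in> S})"])
  show "\<forall>A\<in>families (Suc n). (\<lambda>(P, Q). glue n P Q)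
      ({S \<in> A. n \<notin> S}, (\<lambda>S. S - {n}) ` {S \<in> A. n \<in> S}) = A"
    by (auto simp: glue_def image_image insert_absorb)
  have "{S \<in> glue n P Q. n \<notin> S} = P \<and> (\<lambda>S. S - {n}) ` {S \<in> glue n P Q. n \<in> S} = Q"
    if "P \<in> families n" "Q \<in> families n" for P Q
  proof
    have notin: "S \<in> P \<union> Q \<Longrightarrow> n \<notin> S" for S
      using that by (auto simp: families_def)
    show "{S \<in> glue n P Q. n \<notin> S} = P"
      using notin by (auto simp: glue_def)
    have "{S \<in> glue n P Q. n \<in> S} = insert n ` Q"
      using notin by (auto simp: glue_def)
    moreover have "(\<lambda>S. S - {n}) ` insert n ` Q = (\<lambda>S. S) ` Q"
      unfolding image_image using notin by (intro image_cong) auto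
    ultimately show "(\<lambda>S. S - {n}) ` {S \<in> glue n P Q. n \<in> S} = Q"
      by simp
  qed
  then show "\<forall>PQ\<in>families n \<times> families n.
      (\<lambda>A. ({S \<in> A. n \<notin> S}, (\<lambda>S. S - {n}) ` {S \<in> A. n \<in> S})) ((\<lambda>(P, Q). glue n P Q) PQ) = PQ"
    by auto
  show "(\<lambda>(P, Q). glue n P Q) ` (families n \<times> families n) \<subseteq> families (Suc n)"
    by (fastforce simp: families_def glue_def)
  show "(\<lambda>A. ({S \<in> A. n \<notin> S}, (\<lambda>S. S - {n}) ` {S \<in> A. n \<in> S})) ` families (Suc n)
      \<subseteq> families n \<times> families n"
    unfolding families_def by (fastforce simp: less_Suc_eq)
qed

definition indicator_row :: "nat \<Rightarrow> nat set \<Rightarrow> nat list" where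
  "indicator_row m S = map (\<lambda>c. of_bool (c \<in> S)) [0..<m]"

lemma nth_indicator_row: "c < m \<Longrightarrow> indicator_row m S ! c = of_bool (c \<in> S)"
  by (simp add: indicator_row_def)

lemma inj_on_indicator_row: "inj_on (indicator_row m) (Pow {..<m})"
proof (rule inj_onI)
  fix S T assume S: "S \<in> Pow {..<m}" and T: "T \<in> Pow {..<m}"
    and eq: "indicator_row m S = indicator_row m T"
  have "c \<in> S \<longleftrightarrow> c \<in> T" if "c < m" for c
    using nth_indicator_row[OF that, of S] nth_indicator_row[OF that, of T] eq by (simp add: of_bool_eq_iff)
  then show "S = T" using S T by blast
qed

lemma lexord_less_than_iff: "(xs, ys) \<in> lexord less_than \<longleftrightarrow> xs < (ys :: nat list)"
proof -
  have "less_than = {(u, v). u < v}" by auto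
  then show ?thesis by (simp only: list_less_def)
qed

text \<open>
  The lexicographic order of the rows only serves to make them distinct: any set of distinct rows
  can be sorted, and the column sums do not depend on the order of the rows.
\<close>
lemma Y_iff_family:
  "y \<in> Y k m \<longleftrightarrow> y \<in> carrier_vec m \<and> (\<exists>A \<in> families m. card A = k \<and> (\<forall>c<m. y $ c = deg c A))"
proof (intro iffI conjI; (elim conjE bexE)?)
  assume y: "y \<in> Y k m"
  then show "y \<in> carrier_vec m" by (simp add: Y_def)
  from y obtain Z where Z: "Z \<in> L k m" and yZ: "\<And>c. c < m \<Longrightarrow> y $ c = (\<Sum>i<k. row Z i $ c)"
    by (auto simp: Y_def)
  have dim: "Z \<in> carrier_mat k m" and bin: "\<And>i c. i < k \<Longrightarrow> c < m \<Longrightarrow> Z $$ (i, c) \<in> {0, 1}"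
    and lex: "\<And>i j. i < j \<Longrightarrow> j < k \<Longrightarrow> (list_of_vec (row Z i), list_of_vec (row Z j)) \<in> lexord less_than"
    using Z by (auto simp: L_def)
  define supp where "supp i = {c. c < m \<and> Z $$ (i, c) = 1}" for i
  have row_eq: "row Z i = row Z j" if "supp i = supp j" "i < k" "j < k" for i j
  proof (rule eq_vecI)
    fix c assume "c < dim_vec (row Z j)"
    then have "c < m" using dim by simp
    moreover from this have "Z $$ (i, c) = 1 \<longleftrightarrow> Z $$ (j, c) = 1"
      using that(1) by (auto simp: supp_def set_eq_iff)
    ultimately show "row Z i $ c = row Z j $ c"
      using bin[of i c] bin[of j c] that dim by auto
  qed simp
  have "\<not> supp i = supp j" if "i < j" "j < k" for i j
    using lex[OF that] row_eq[of i j] that by (auto simp: lexord_less_than_iff)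
  then have inj: "inj_on supp {..<k}"
    by (intro inj_onI) (metis lessThan_iff linorder_neqE_nat)
  have "deg c (supp ` {..<k}) = y $ c" if c: "c < m" for c
  proof -
    have "{S \<in> supp ` {..<k}. c \<in> S} = supp ` {i. i < k \<and> Z $$ (i, c) = 1}"
      using c by (auto simp: supp_def)
    then have "deg c (supp ` {..<k}) = card {i. i < k \<and> Z $$ (i, c) = 1}"
      unfolding deg_def by (simp add: card_image inj_on_subset[OF inj] subset_eq)
    also have "\<dots> = (\<Sum>i<k. if Z $$ (i, c) = 1 then 1 else 0)"
      by (simp add: sum.If_cases lessThan_def Collect_conj_eq)
    also have "\<dots> = (\<Sum>i<k. row Z i $ c)"
      using bin[OF _ c] dim c by (intro sum.cong) fastforce+
    finally show ?thesis using yZ[OF c] by simp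
  qed
  moreover have "supp ` {..<k} \<in> families m"
    by (auto simp: families_def supp_def)
  ultimately show "\<exists>A \<in> families m. card A = k \<and> (\<forall>c<m. y $ c = deg c A)"
    using card_image[OF inj] by (intro bexI[of _ "supp ` {..<k}"]) auto
next
  fix A assume y: "y \<in> carrier_vec m" and A: "A \<in> families m" and k: "card A = k"
    and deg: "\<forall>c<m. y $ c = deg c A"
  have inj: "inj_on (indicator_row m) A"
    using A by (intro inj_on_subset[OF inj_on_indicator_row]) (auto simp: families_def)
  define rows where "rows = sorted_list_of_set (indicator_row m ` A)"
  have fin: "finite (indicator_row m ` A)" using finite_family[OF A] by simp
  have set_rows: "set rows = indicator_row m ` A" and dist: "distinct rows"
    and sorted: "sorted_wrt (<) rows"
    unfolding rows_def using fin by auto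
  have len: "length rows = k"
    unfolding rows_def using k card_image[OF inj] by simp
  define Z where "Z = mat k m (\<lambda>(i, c). rows ! i ! c)"
  have row_len: "length (rows ! i) = m" if "i < k" for i
    using that set_rows len nth_mem[of i rows] by (auto simp: indicator_row_def)
  have row_Z: "list_of_vec (row Z i) = rows ! i" if "i < k" for i
    using that row_len[OF that] by (intro nth_equalityI) (auto simp: Z_def list_of_vec_index)
  have "Z $$ (i, c) \<in> {0, 1}" if "i < k" "c < m" for i c
  proof -
    have "rows ! i \<in> indicator_row m ` A" using that len set_rows nth_mem by blast
    then show ?thesis using that by (auto simp: Z_def indicator_row_def)
  qed
  then have "Z \<in> L k m"
    using sorted len row_Z
    by (auto simp: L_def Z_def[THEN arg_cong, of "\<lambda>Z. Z \<in> carrier_mat k m"] lexord_less_than_iff sorted_wrt_iff_nth_less)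
  moreover have "y $ c = (\<Sum>i<k. row Z i $ c)" if c: "c < m" for c
  proof -
    have "(\<Sum>i<k. row Z i $ c) = (\<Sum>i<length rows. rows ! i ! c)"
      using c len by (intro sum.cong) (auto simp: Z_def)
    also have "\<dots> = (\<Sum>xs\<in>set rows. xs ! c)"
      using dist by (simp add: sum_list_sum_nth atLeast0LessThan flip: sum_list_distinct_conv_sum_set)
    also have "\<dots> = (\<Sum>S\<in>A. of_bool (c \<in> S))"
      unfolding set_rows sum.reindex[OF inj] o_def using c by (simp add: indicator_row_def)
    also have "\<dots> = deg c A"
      using finite_family[OF A] by (simp add: deg_def Int_def)
    finally show ?thesis using deg c by simp
  qed
  ultimately show "y \<in> Y k m" using y by (auto simp: Y_def)
qed
section \<open>Splitting flows\<close>

text \<open>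
  Families with \<open>j\<close> members are split by one coordinate after the other, the coordinate \<open>n - 1\<close>
  first. The number \<open>x r a b\<close> is the amount of families of \<open>a + b\<close> subsets of \<open>{..r}\<close> that fall into
  \<open>a\<close> sets without \<open>r\<close> and \<open>b\<close> sets with \<open>r\<close>. Both parts go on as families of subsets of \<open>{..<r}\<close>,
  so one unit of \<open>x r a b\<close> feeds the sizes \<open>a\<close> and \<open>b\<close> of the next level (\<open>inflow\<close>, where \<open>a = b\<close>
  counts twice) while it uses up one unit of the size \<open>a + b\<close> (\<open>outflow\<close>). It puts \<open>b\<close> members on the
  coordinate \<open>r\<close> (\<open>load\<close>). The bound \<open>K\<close> on the sizes keeps all sums finite.
\<close>
definition inflow :: "nat \<Rightarrow> (nat \<Rightarrow> nat \<Rightarrow> nat \<Rightarrow> real) \<Rightarrow> nat \<Rightarrow> nat \<Rightarrow> real" where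
  "inflow K x r j = (\<Sum>a\<le>K. \<Sum>b\<le>K. (of_bool (a = j) + of_bool (b = j)) * x r a b)"

definition outflow :: "nat \<Rightarrow> (nat \<Rightarrow> nat \<Rightarrow> nat \<Rightarrow> real) \<Rightarrow> nat \<Rightarrow> nat \<Rightarrow> real" where
  "outflow K x r j = (\<Sum>a\<le>K. \<Sum>b\<le>K. of_bool (a + b = j) * x r a b)"

definition load :: "nat \<Rightarrow> (nat \<Rightarrow> nat \<Rightarrow> nat \<Rightarrow> real) \<Rightarrow> nat \<Rightarrow> real" where
  "load K x r = (\<Sum>a\<le>K. \<Sum>b\<le>K. real b * x r a b)"

text \<open>
  A flow splits the supply \<open>s j\<close> of families of each size \<open>j\<close> down to the empty ground set, over
  which there are only two families: the empty one and \<open>{{}}\<close>. So just the sizes 0 and 1 may be left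
  over, and it is here that distinctness of the rows enters. Nonnegativity is kept apart from the
  balances, so that flows are closed under all linear combinations.
\<close>
fun flow :: "nat \<Rightarrow> nat \<Rightarrow> (nat \<Rightarrow> real) \<Rightarrow> (nat \<Rightarrow> nat \<Rightarrow> nat \<Rightarrow> real) \<Rightarrow> bool" where
  "flow K 0 s x \<longleftrightarrow> (\<forall>j\<ge>2. s j = 0)"
| "flow K (Suc n) s x \<longleftrightarrow>
     (\<forall>j. outflow K x n j = s j) \<and> flow K n (inflow K x n) x"

lemma inflow_lin: "inflow K (\<lambda>r a b. u * x r a b + v * x' r a b) r j = u * inflow K x r j + v * inflow K x' r j"
  unfolding inflow_def sum_distrib_left sum.distrib[symmetric]
  by (intro sum.cong refl) (simp add: algebra_simps)

lemma outflow_lin: "outflow K (\<lambda>r a b. u * x r a b + v * x' r a b) r j = u * outflow K x r j + v * outflow K x' r j"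
  unfolding outflow_def sum_distrib_left sum.distrib[symmetric]
  by (intro sum.cong refl) (simp add: algebra_simps)

lemma load_lin: "load K (\<lambda>r a b. u * x r a b + v * x' r a b) r = u * load K x r + v * load K x' r"
  unfolding load_def sum_distrib_left sum.distrib[symmetric]
  by (intro sum.cong refl) (simp add: algebra_simps)

lemma flow_linear_combination:
  assumes "flow K n s x" "flow K n s' x'"
  shows "flow K n (\<lambda>j. u * s j + v * s' j) (\<lambda>r a b. u * x r a b + v * x' r a b)"
  using assms
proof (induction n arbitrary: s s')
  case (Suc n)
  then show ?case
    by (simp add: outflow_lin inflow_lin[abs_def])
qed simp

lemma flow_cong:
  assumes "\<And>r a b. r < n \<Longrightarrow> x r a b = x' r a b"
  shows "flow K n s x \<longleftrightarrow> flow K n s x'"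
  using assms
proof (induction n arbitrary: s)
  case (Suc n)
  have "outflow K x n = outflow K x' n" "inflow K x n = inflow K x' n"
    using Suc.prems by (auto simp: outflow_def inflow_def)
  then show ?case using Suc by simp
qed simp

lemma glue_cases:
  assumes "A \<in> families (Suc n)"
  obtains P Q where "P \<in> families n" "Q \<in> families n" "A = glue n P Q"
proof -
  have "A \<in> (\<lambda>(P, Q). glue n P Q) ` (families n \<times> families n)"
    using bij_betw_imp_surj_on[OF bij_betw_glue, of n] assms by simp
  then show thesis using that by auto
qed

section \<open>Flows and families\<close>

text \<open>
  One unit of a family is split along the actual parts of the family and of its parts: the
  flow of \<open>glue n P Q\<close> is the sum of those of \<open>P\<close> and \<open>Q\<close>, with a single unit on the top split.
\<close>
lemma flow_of_family:
  assumes "A \<in> families n" "card A \<le> K"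
  shows "\<exists>x. (\<forall>r a b. 0 \<le> x r a b) \<and> flow K n (\<lambda>j. of_bool (j = card A)) x \<and> (\<forall>c<n. load K x c = deg c A)"
  using assms
proof (induction n arbitrary: A)
  case 0
  then have "card A \<le> card {{} :: nat set}"
    by (intro card_mono) (auto simp: families_def)
  then show ?case by (intro exI[of _ "\<lambda>_ _ _. 0"]) auto
next
  case (Suc n)
  from Suc.prems(1) obtain P Q where PQ: "P \<in> families n" "Q \<in> families n" and A: "A = glue n P Q"
    by (rule glue_cases)
  have K: "card P + card Q \<le> K" using Suc.prems(2) PQ by (simp add: A card_glue)
  obtain x x' where x: "\<And>r a b. 0 \<le> x r a b" "flow K n (\<lambda>j. of_bool (j = card P)) x" "\<And>c. c < n \<Longrightarrow> load K x c = deg c P"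
    and x': "\<And>r a b. 0 \<le> x' r a b" "flow K n (\<lambda>j. of_bool (j = card Q)) x'" "\<And>c. c < n \<Longrightarrow> load K x' c = deg c Q"
    using Suc.IH[OF PQ(1)] Suc.IH[OF PQ(2)] K by (auto; blast)
  define X where "X r a b = (if r = n then of_bool (a = card P) * of_bool (b = card Q)
    else x r a b + x' r a b)" for r a b
  have single: "(\<Sum>a\<le>K. \<Sum>b\<le>K. h a b * X n a b) = h (card P) (card Q)" for h :: "nat \<Rightarrow> nat \<Rightarrow> real"
    using K by (simp add: X_def mult.assoc[symmetric] flip: sum_distrib_right)
  have "flow K n (\<lambda>j. of_bool (j = card P) + of_bool (j = card Q)) X"
    using flow_linear_combination[OF x(2) x'(2), of 1 1]
    by (subst flow_cong[where x' = "\<lambda>r a b. x r a b + x' r a b"]) (auto simp: X_def)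
  moreover have "inflow K X n = (\<lambda>j. of_bool (j = card P) + of_bool (j = card Q))"
    unfolding inflow_def by (subst single) (simp add: eq_commute)
  moreover have "outflow K X n j = of_bool (j = card A)" for j
    unfolding outflow_def by (subst single) (simp add: A card_glue[OF PQ] eq_commute)
  moreover have "load K X c = deg c A" if "c < Suc n" for c
  proof (cases "c = n")
    case True
    then show ?thesis unfolding load_def by (simp add: single A deg_glue_new[OF PQ])
  next
    case False
    then have "load K X c = load K x c + load K x' c"
      using load_lin[of K 1 x 1 x' c] by (simp add: X_def load_def)
    then show ?thesis using False that PQ by (simp add: x(3) x'(3) A deg_glue_old)
  qed
  moreover have "0 \<le> X r a b" for r a b using x(1) x'(1) by (simp add: X_def)
  ultimately show ?case by (intro exI[of _ X]) auto
qed

lemma inflow_nonneg: "(\<And>a b. 0 \<le> x r a b) \<Longrightarrow> 0 \<le> inflow K x r j"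
  by (auto simp: inflow_def intro!: sum_nonneg)

lemma inflow_eq:
  "inflow K x r j = (if j \<le> K then (\<Sum>b\<le>K. x r j b) + (\<Sum>a\<le>K. x r a j) else 0)"
proof -
  have "(\<Sum>a\<le>K. \<Sum>b\<le>K. of_bool (a = j) * x r a b) = (if j \<le> K then \<Sum>b\<le>K. x r j b else 0)"
    by (simp flip: sum_distrib_left)
  moreover have "(\<Sum>a\<le>K. \<Sum>b\<le>K. of_bool (b = j) * x r a b) = (if j \<le> K then \<Sum>a\<le>K. x r a j else 0)"
    by simp
  ultimately show ?thesis by (simp add: inflow_def algebra_simps sum.distrib)
qed

text \<open>
  The converse, and the heart of the matter: a fractional flow is a weighted sum of families.
  By induction the flow below level \<open>n\<close> comes from a weight \<open>\<mu>\<close> on the families of subsets of \<open>{..<n}\<close>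
  whose total on the families of size \<open>j\<close> is the amount \<open>t j\<close> that level \<open>n\<close> delivers. Hence
  \<open>p = \<mu> / t\<close> is a probability distribution on the families of each size that occurs, and one can
  pass from the split \<open>(a, b)\<close> to concrete parts by drawing \<open>P\<close> of size \<open>a\<close> and \<open>Q\<close> of size \<open>b\<close>
  independently. Both the amount of each split and, by linearity, the degrees are reproduced, because
  the degrees of \<open>glue n P Q\<close> are sums of a function of \<open>P\<close> and a function of \<open>Q\<close>.
\<close>
lemma flow_decomposition:
  assumes pos: "\<And>r a b. 0 \<le> x r a b" and "flow K n s x" "\<And>j. 0 \<le> s j"
  shows "\<exists>\<mu>. (\<forall>A. 0 \<le> \<mu> A) \<and> (\<forall>j. (\<Sum>A\<in>families n. of_bool (card A = j) * \<mu> A) = s j)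
    \<and> (\<forall>c<n. (\<Sum>A\<in>families n. \<mu> A * real (deg c A)) = load K x c)"
  using assms(2,3)
proof (induction n arbitrary: s)
  case 0
  have "families 0 = {{}, {{}}}" by (auto simp: families_def)
  then have "(\<Sum>A\<in>families 0. of_bool (card A = j) * s (card A))
      = of_bool (j = 0) * s 0 + of_bool (j = 1) * s 1" for j
    by (simp add: of_bool_def)
  also have "of_bool (j = 0) * s 0 + of_bool (j = 1) * s 1 = s j" for j
    using 0 by (cases "j \<ge> 2") (auto simp: not_le less_2_cases_iff)
  finally have "(\<Sum>A\<in>families 0. of_bool (card A = j) * s (card A)) = s j" for j .
  with 0 show ?case by (intro exI[of _ "\<lambda>A. s (card A)"]) blast
next
  case (Suc n)
  let ?F = "families n"
  have out: "outflow K x n j = s j" and rest: "flow K n (inflow K x n) x" for j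
    using Suc.prems by auto
  define t where "t = inflow K x n"
  have t_nonneg: "0 \<le> t j" for j
    unfolding t_def using pos by (rule inflow_nonneg)
  obtain \<mu> where \<mu>: "\<And>A. 0 \<le> \<mu> A" "\<And>j. (\<Sum>A\<in>?F. of_bool (card A = j) * \<mu> A) = t j"
      "\<And>c. c < n \<Longrightarrow> (\<Sum>A\<in>?F. \<mu> A * real (deg c A)) = load K x c"
    using Suc.IH[OF rest] t_nonneg unfolding t_def by blast
  have t_eq: "t j = (\<Sum>b\<le>K. x n j b) + (\<Sum>a\<le>K. x n a j)" if "j \<le> K" for j
    using that by (simp add: t_def inflow_eq)
  have t_large: "t j = 0" if "\<not> j \<le> K" for j
    using that by (simp add: t_def inflow_eq)
  have row: "x n a b = 0" if "t a = 0" "a \<le> K" "b \<le> K" for a b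
  proof -
    have "x n a b \<le> (\<Sum>b\<le>K. x n a b)"
      using pos that(3) by (intro member_le_sum) auto
    also have "\<dots> \<le> t a" using t_eq[OF that(2)] pos by (simp add: sum_nonneg)
    finally show ?thesis using pos[of n a b] that(1) by simp
  qed
  have col: "x n a b = 0" if "t b = 0" "a \<le> K" "b \<le> K" for a b
  proof -
    have "x n a b \<le> (\<Sum>a\<le>K. x n a b)"
      using pos that(2) by (intro member_le_sum) auto
    also have "\<dots> \<le> t b" using t_eq[OF that(3)] pos by (simp add: sum_nonneg)
    finally show ?thesis using pos[of n a b] that(1) by simp
  qed
  define p where "p A = \<mu> A / t (card A)" for A
  have p_large: "p A = 0" if "\<not> card A \<le> K" for A
    using t_large[OF that] by (simp add: p_def)
  \<comment> \<open>A size that is never delivered carries no weight, so the division by \<open>t\<close> loses nothing.\<close>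
  have t_p: "t (card A) * p A = \<mu> A" if "A \<in> ?F" for A
  proof (cases "t (card A) = 0")
    case True
    have "of_bool (card A = card A) * \<mu> A \<le> (\<Sum>B\<in>?F. of_bool (card B = card A) * \<mu> B)"
      using \<mu>(1) that by (intro member_le_sum) auto
    then have "\<mu> A = 0" using \<mu>(1)[of A] \<mu>(2)[of "card A"] True by simp
    then show ?thesis using True by simp
  qed (simp add: p_def)
  \<comment> \<open>Sizes with \<open>t b = 0\<close> have no distribution (\<open>p\<close> is 0 there), hence the condition on \<open>h\<close>; the
    amounts \<open>x n a b\<close> satisfy it in both arguments by \<open>row\<close> and \<open>col\<close>.\<close>
  have average: "(\<Sum>Q\<in>?F. h (card Q) * p Q) = (\<Sum>b\<le>K. h b)"
    if "\<And>b. b \<le> K \<Longrightarrow> t b = 0 \<Longrightarrow> h b = 0" for h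
  proof -
    have "(\<Sum>Q\<in>?F. h (card Q) * p Q) = (\<Sum>Q\<in>?F. \<Sum>b\<le>K. of_bool (b = card Q) * (h b * p Q))"
      using p_large by (intro sum.cong) (auto simp: Int_insert_right)
    also have "\<dots> = (\<Sum>b\<le>K. \<Sum>Q\<in>?F. of_bool (b = card Q) * (h b * p Q))"
      by (rule sum.swap)
    also have "\<dots> = (\<Sum>b\<le>K. h b / t b * (\<Sum>Q\<in>?F. of_bool (card Q = b) * \<mu> Q))"
      unfolding sum_distrib_left by (intro sum.cong) (auto simp: p_def)
    also have "\<dots> = (\<Sum>b\<le>K. h b)"
      using that by (intro sum.cong) (auto simp: \<mu>(2))
    finally show ?thesis .
  qed
  define w where "w P Q = x n (card P) (card Q) * (p P * p Q)" for P Q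
  have avg_Q: "(\<Sum>Q\<in>?F. h (card Q) * w P Q) = (\<Sum>b\<le>K. h b * x n (card P) b) * p P" for h P
  proof (cases "card P \<le> K")
    case True
    have "(\<Sum>Q\<in>?F. h (card Q) * w P Q) = (\<Sum>Q\<in>?F. (h (card Q) * x n (card P) (card Q)) * p Q) * p P"
      unfolding w_def sum_distrib_right by (simp add: mult_ac)
    also have "(\<Sum>Q\<in>?F. (h (card Q) * x n (card P) (card Q)) * p Q) = (\<Sum>b\<le>K. h b * x n (card P) b)"
      using True col by (intro average) auto
    finally show ?thesis .
  qed (simp add: w_def p_large)
  have row_w: "(\<Sum>Q\<in>?F. w P Q) = (\<Sum>b\<le>K. x n (card P) b) * p P" for P
    using avg_Q[of "\<lambda>_. 1"] by simp
  have avg_P: "(\<Sum>P\<in>?F. w P Q) = (\<Sum>a\<le>K. x n a (card Q)) * p Q" for Q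
  proof (cases "card Q \<le> K")
    case True
    have "(\<Sum>P\<in>?F. w P Q) = (\<Sum>P\<in>?F. x n (card P) (card Q) * p P) * p Q"
      unfolding w_def sum_distrib_right by (simp add: mult_ac)
    also have "(\<Sum>P\<in>?F. x n (card P) (card Q) * p P) = (\<Sum>a\<le>K. x n a (card Q))"
      using True row by (intro average) auto
    finally show ?thesis .
  qed (simp add: w_def p_large)
  have types: "(\<Sum>P\<in>?F. \<Sum>Q\<in>?F. h (card P) (card Q) * w P Q) = (\<Sum>a\<le>K. \<Sum>b\<le>K. h a b * x n a b)" for h
    unfolding avg_Q using row by (intro average) auto
  \<comment> \<open>A family \<open>A\<close> is drawn as first or as second part of a split. In total that happens with
    weight \<open>t (card A) * p A = \<mu> A\<close>, because \<open>t j\<close> counts both the first and the second parts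
    of size \<open>j\<close>.\<close>
  have marginals: "(\<Sum>P\<in>?F. \<Sum>Q\<in>?F. w P Q * (f P + f Q)) = (\<Sum>A\<in>?F. \<mu> A * f A)" for f
  proof -
    have "(\<Sum>P\<in>?F. \<Sum>Q\<in>?F. w P Q * (f P + f Q))
        = (\<Sum>P\<in>?F. (\<Sum>Q\<in>?F. w P Q) * f P) + (\<Sum>Q\<in>?F. (\<Sum>P\<in>?F. w P Q) * f Q)"
      unfolding sum_distrib_right distrib_left sum.distrib
      using sum.swap[of "\<lambda>P Q. w P Q * f Q" ?F ?F] by simp
    also have "\<dots> = (\<Sum>A\<in>?F. ((\<Sum>b\<le>K. x n (card A) b) + (\<Sum>a\<le>K. x n a (card A))) * p A * f A)"
      unfolding row_w avg_P
      by (subst sum.distrib[symmetric]) (intro sum.cong refl, simp add: distrib_right)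
    also have "\<dots> = (\<Sum>A\<in>?F. t (card A) * p A * f A)"
      by (intro sum.cong refl) (auto simp: t_eq intro!: p_large)
    also have "\<dots> = (\<Sum>A\<in>?F. \<mu> A * f A)"
      by (intro sum.cong) (simp_all add: t_p)
    finally show ?thesis .
  qed
  define g where "g = (\<lambda>(P, Q). glue n P Q)"
  \<comment> \<open>The weight \<open>w\<close> on pairs, transported along the bijection between pairs of parts and families.\<close>
  define \<nu> where "\<nu> A = (if A \<in> families (Suc n) then case inv_into (?F \<times> ?F) g A of (P, Q) \<Rightarrow> w P Q else 0)" for A
  have bij: "bij_betw g (?F \<times> ?F) (families (Suc n))" unfolding g_def by (rule bij_betw_glue)
  have p_nonneg: "0 \<le> p A" for A by (simp add: p_def \<mu>(1) t_nonneg)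
  have "0 \<le> \<nu> A" for A
    by (simp add: \<nu>_def w_def pos p_nonneg split: prod.split)
  have \<nu>_glue: "\<nu> (glue n P Q) = w P Q" if "P \<in> ?F" "Q \<in> ?F" for P Q
    using bij_betw_inv_into_left[OF bij, of "(P, Q)"] bij_betw_apply[OF bij, of "(P, Q)"] that
    by (simp add: \<nu>_def g_def)
  have reindex: "(\<Sum>A\<in>families (Suc n). h A * \<nu> A) = (\<Sum>P\<in>?F. \<Sum>Q\<in>?F. h (glue n P Q) * w P Q)" for h
  proof -
    have "(\<Sum>A\<in>families (Suc n). h A * \<nu> A) = (\<Sum>PQ\<in>?F \<times> ?F. h (g PQ) * \<nu> (g PQ))"
      by (rule sum.reindex_bij_betw[OF bij, symmetric])
    also have "\<dots> = (\<Sum>P\<in>?F. \<Sum>Q\<in>?F. h (glue n P Q) * \<nu> (glue n P Q))"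
      by (simp add: sum.cartesian_product g_def split_def)
    also have "\<dots> = (\<Sum>P\<in>?F. \<Sum>Q\<in>?F. h (glue n P Q) * w P Q)"
      by (intro sum.cong refl) (simp add: \<nu>_glue)
    finally show ?thesis .
  qed
  have "(\<Sum>A\<in>families (Suc n). of_bool (card A = j) * \<nu> A) = s j" for j
  proof -
    have "(\<Sum>A\<in>families (Suc n). of_bool (card A = j) * \<nu> A)
        = (\<Sum>P\<in>?F. \<Sum>Q\<in>?F. of_bool (card P + card Q = j) * w P Q)"
      unfolding reindex by (intro sum.cong refl) (simp add: card_glue)
    also have "\<dots> = s j"
      using types[of "\<lambda>a b. of_bool (a + b = j)"] out[of j] by (simp add: outflow_def)
    finally show ?thesis .
  qed
  moreover have "(\<Sum>A\<in>families (Suc n). \<nu> A * real (deg c A)) = load K x c" if "c < Suc n" for c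
  proof -
    have eq: "(\<Sum>A\<in>families (Suc n). \<nu> A * real (deg c A))
        = (\<Sum>P\<in>?F. \<Sum>Q\<in>?F. real (deg c (glue n P Q)) * w P Q)"
      using reindex[of "\<lambda>A. real (deg c A)"] by (simp add: mult.commute)
    show ?thesis
    proof (cases "c = n")
      case True
      have "(\<Sum>P\<in>?F. \<Sum>Q\<in>?F. real (deg c (glue n P Q)) * w P Q)
          = (\<Sum>P\<in>?F. \<Sum>Q\<in>?F. real (card Q) * w P Q)"
        by (intro sum.cong refl) (simp add: True deg_glue_new)
      then show ?thesis
        using eq types[of "\<lambda>a b. real b"] by (simp add: load_def True)
    next
      case False
      then have "c < n" using that by simp
      then have "(\<Sum>P\<in>?F. \<Sum>Q\<in>?F. real (deg c (glue n P Q)) * w P Q)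
          = (\<Sum>P\<in>?F. \<Sum>Q\<in>?F. w P Q * (real (deg c P) + real (deg c Q)))"
        by (intro sum.cong refl) (simp add: deg_glue_old)
      then show ?thesis
        using eq marginals[of "\<lambda>A. real (deg c A)"] \<mu>(3)[OF \<open>c < n\<close>] by simp
    qed
  qed
  ultimately show ?case using \<open>\<And>A. 0 \<le> \<nu> A\<close> by blast
qed
section \<open>Flows as solutions of a linear system\<close>

text \<open>
  A finite linear system in nonnegative unknowns indexed by an arbitrary finite set \<open>V\<close>, with equations
  indexed by \<open>I\<close>, becomes a matrix system by enumerating \<open>I\<close> and \<open>V\<close>.
\<close>
lemma linear_system_as_matrices:
  fixes e :: "'i \<Rightarrow> nat \<Rightarrow> real" and f :: "'i \<Rightarrow> 'v \<Rightarrow> real" and g :: "'i \<Rightarrow> real"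
  assumes "finite I" "finite V"
  shows "\<exists>E F h. E \<in> carrier_mat (card I) m \<and> F \<in> carrier_mat (card I) (card V) \<and> h \<in> carrier_vec (card I) \<and>
    (\<forall>y \<in> carrier_vec m.
      (\<exists>w \<in> carrier_vec (card V). 0\<^sub>v (card V) \<le> w \<and> E *\<^sub>v y + F *\<^sub>v w = h) \<longleftrightarrow>
      (\<exists>x. (\<forall>v. 0 \<le> x v) \<and> (\<forall>i\<in>I. (\<Sum>c<m. e i c * y $ c) + (\<Sum>v\<in>V. f i v * x v) = g i)))"
proof -
  obtain \<alpha> where \<alpha>: "bij_betw \<alpha> {..<card I} I"
    using ex_bij_betw_nat_finite[OF assms(1)] by (auto simp: atLeast0LessThan)
  obtain \<beta> where \<beta>: "bij_betw \<beta> {..<card V} V"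
    using ex_bij_betw_nat_finite[OF assms(2)] by (auto simp: atLeast0LessThan)
  define E where "E = mat (card I) m (\<lambda>(i, c). e (\<alpha> i) c)"
  define F where "F = mat (card I) (card V) (\<lambda>(i, t). f (\<alpha> i) (\<beta> t))"
  define h where "h = vec (card I) (\<lambda>i. g (\<alpha> i))"
  have solves_iff: "E *\<^sub>v y + F *\<^sub>v w = h \<longleftrightarrow>
      (\<forall>i\<in>I. (\<Sum>c<m. e i c * y $ c) + (\<Sum>v\<in>V. f i v * x v) = g i)"
    if y: "y \<in> carrier_vec m" and w: "w \<in> carrier_vec (card V)"
      and wx: "\<And>t. t < card V \<Longrightarrow> w $ t = x (\<beta> t)" for y w x
  proof -
    have "(F *\<^sub>v w) $ i = (\<Sum>v\<in>V. f (\<alpha> i) v * x v)" if "i < card I" for i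
    proof -
      have "(F *\<^sub>v w) $ i = (\<Sum>t<card V. f (\<alpha> i) (\<beta> t) * x (\<beta> t))"
        using that w wx by (auto simp: F_def scalar_prod_def atLeast0LessThan intro!: sum.cong)
      then show ?thesis using sum.reindex_bij_betw[OF \<beta>, of "\<lambda>v. f (\<alpha> i) v * x v"] by simp
    qed
    moreover have "(E *\<^sub>v y) $ i = (\<Sum>c<m. e (\<alpha> i) c * y $ c)" if "i < card I" for i
      using that y by (auto simp: E_def scalar_prod_def atLeast0LessThan intro!: sum.cong)
    ultimately have "E *\<^sub>v y + F *\<^sub>v w = h \<longleftrightarrow> (\<forall>i\<in>{..<card I}.
        (\<Sum>c<m. e (\<alpha> i) c * y $ c) + (\<Sum>v\<in>V. f (\<alpha> i) v * x v) = g (\<alpha> i))"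
      by (auto simp: vec_eq_iff h_def E_def F_def)
    also have "\<dots> \<longleftrightarrow> (\<forall>i\<in>\<alpha> ` {..<card I}.
        (\<Sum>c<m. e i c * y $ c) + (\<Sum>v\<in>V. f i v * x v) = g i)"
      by blast
    finally show ?thesis using bij_betw_imp_surj_on[OF \<alpha>] by simp
  qed
  have "(\<exists>w \<in> carrier_vec (card V). 0\<^sub>v (card V) \<le> w \<and> E *\<^sub>v y + F *\<^sub>v w = h) \<longleftrightarrow>
      (\<exists>x. (\<forall>v. 0 \<le> x v) \<and> (\<forall>i\<in>I. (\<Sum>c<m. e i c * y $ c) + (\<Sum>v\<in>V. f i v * x v) = g i))"
    if y: "y \<in> carrier_vec m" for y
  proof (intro iffI; elim bexE exE conjE)
    fix w assume w: "w \<in> carrier_vec (card V)" "0\<^sub>v (card V) \<le> w" "E *\<^sub>v y + F *\<^sub>v w = h"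
    define x where "x v = (if v \<in> V then w $ inv_into {..<card V} \<beta> v else 0)" for v
    have "w $ t = x (\<beta> t)" if "t < card V" for t
      using that bij_betw_apply[OF \<beta>, of t] bij_betw_inv_into_left[OF \<beta>, of t] by (simp add: x_def)
    moreover have "0 \<le> x v" for v
      using w(1,2) bij_betw_apply[OF bij_betw_inv_into[OF \<beta>], of v] by (auto simp: x_def less_eq_vec_def)
    ultimately show "\<exists>x. (\<forall>v. 0 \<le> x v) \<and>
        (\<forall>i\<in>I. (\<Sum>c<m. e i c * y $ c) + (\<Sum>v\<in>V. f i v * x v) = g i)"
      using solves_iff[OF y w(1)] w(3) by blast
  next
    fix x assume x: "\<forall>v. 0 \<le> x v" "\<forall>i\<in>I. (\<Sum>c<m. e i c * y $ c) + (\<Sum>v\<in>V. f i v * x v) = g i"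
    let ?w = "vec (card V) (\<lambda>t. x (\<beta> t))"
    have "E *\<^sub>v y + F *\<^sub>v ?w = h" using solves_iff[OF y, of ?w x] x(2) by simp
    moreover have "0\<^sub>v (card V) \<le> ?w" using x(1) by (simp add: less_eq_vec_def)
    ultimately show "\<exists>w \<in> carrier_vec (card V). 0\<^sub>v (card V) \<le> w \<and> E *\<^sub>v y + F *\<^sub>v w = h"
      by (intro bexI[of _ ?w]) auto
  qed
  then show ?thesis
    by (intro exI[of _ E] exI[of _ F] exI[of _ h]) (auto simp: E_def F_def h_def)
qed

text \<open>
  The balance equations for all levels at once: what arrives at level \<open>r\<close> in the size \<open>j\<close> is what
  level \<open>r - 1\<close> splits. Level \<open>r = 0\<close> is the bottom, where sizes below 2 are unconstrained and larger
  ones are excluded.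
\<close>
lemma flow_iff_balance:
  "flow K n s x \<longleftrightarrow> (\<forall>r\<le>n. \<forall>j. (r = 0 \<longrightarrow> 2 \<le> j) \<longrightarrow>
     (if r = n then s j else inflow K x r j) = (if r = 0 then 0 else outflow K x (r - 1) j))"
proof (induction n arbitrary: s)
  case (Suc n)
  have "(if r = n then inflow K x n j else inflow K x r j) = inflow K x r j" for r j
    by simp
  then show ?case by (auto simp: Suc le_Suc_eq)
qed auto

lemma sum_level:
  fixes h :: "nat \<Rightarrow> nat \<Rightarrow> real" and x :: "nat \<Rightarrow> nat \<Rightarrow> nat \<Rightarrow> real"
  assumes "r < m"
  shows "(\<Sum>(r', a, b)\<in>{..<m} \<times> {..K} \<times> {..K}. of_bool (r' = r) * (h a b * x r' a b))
    = (\<Sum>a\<le>K. \<Sum>b\<le>K. h a b * x r a b)"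
proof -
  have "(\<Sum>(r', a, b)\<in>{..<m} \<times> {..K} \<times> {..K}. of_bool (r' = r) * (h a b * x r' a b))
      = (\<Sum>r'<m. of_bool (r' = r) * (\<Sum>a\<le>K. \<Sum>b\<le>K. h a b * x r' a b))"
    unfolding sum_distrib_left by (simp only: sum.cartesian_product split_def fst_conv snd_conv)
  also have "\<dots> = (\<Sum>a\<le>K. \<Sum>b\<le>K. h a b * x r a b)"
    using assms by (subst sum_of_bool_mult_eq) (auto simp: Int_insert_right)
  finally show ?thesis .
qed

text \<open>
  The signed incidence matrix of the directed hypergraph whose nodes are the pairs \<open>(r, j)\<close> and whose
  hyperarc \<open>(r', a, b)\<close> has the tail \<open>(r' + 1, a + b)\<close> and the two heads \<open>(r', a)\<close> and \<open>(r', b)\<close>.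
\<close>
definition incidence :: "nat \<Rightarrow> nat \<Rightarrow> nat \<times> nat \<times> nat \<Rightarrow> real" where
  "incidence r j = (\<lambda>(r', a, b). of_bool (r' = r) * (of_bool (a = j) + of_bool (b = j))
     - of_bool (Suc r' = r) * of_bool (a + b = j))"

lemma sum_incidence:
  assumes "r \<le> m"
  shows "(\<Sum>v\<in>{..<m} \<times> {..K} \<times> {..K}. incidence r j v * (case v of (r', a, b) \<Rightarrow> x r' a b))
    = (if r = m then 0 else inflow K x r j) - (if r = 0 then 0 else outflow K x (r - 1) j)"
proof -
  let ?V = "{..<m} \<times> {..K} \<times> {..K}"
  have "(\<Sum>v\<in>?V. incidence r j v * (case v of (r', a, b) \<Rightarrow> x r' a b))
      = (\<Sum>(r', a, b)\<in>?V. of_bool (r' = r) * ((of_bool (a = j) + of_bool (b = j)) * x r' a b))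
      - (\<Sum>(r', a, b)\<in>?V. of_bool (Suc r' = r) * (of_bool (a + b = j) * x r' a b))"
    unfolding sum_subtractf[symmetric]
    by (intro sum.cong refl) (auto simp: incidence_def left_diff_distrib mult.assoc)
  moreover have "(\<Sum>(r', a, b)\<in>?V. of_bool (r' = r) * ((of_bool (a = j) + of_bool (b = j)) * x r' a b))
      = (if r = m then 0 else inflow K x r j)"
  proof (cases "r = m")
    case False
    then show ?thesis using assms by (simp add: sum_level inflow_def)
  qed (auto intro!: sum.neutral)
  moreover have "(\<Sum>(r', a, b)\<in>?V. of_bool (Suc r' = r) * (of_bool (a + b = j) * x r' a b))
      = (if r = 0 then 0 else outflow K x (r - 1) j)"
  proof (cases r)
    case (Suc r0)
    then show ?thesis using assms sum_level[of r0 m "\<lambda>a b. of_bool (a + b = j)" x K]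
      by (simp add: outflow_def)
  qed (auto intro!: sum.neutral)
  ultimately show ?thesis by simp
qed

lemma outflow_large: "2 * K < j \<Longrightarrow> outflow K x r j = 0"
  by (auto simp: outflow_def intro!: sum.neutral)

definition flow_polytope :: "nat \<Rightarrow> nat \<Rightarrow> real vec set" where
  "flow_polytope k m = {y \<in> carrier_vec m. \<exists>x. (\<forall>r a b. 0 \<le> x r a b) \<and>
     flow k m (\<lambda>j. of_bool (j = k)) x \<and> (\<forall>c<m. load k x c = y $ c)}"

text \<open>
  The unknowns are the \<open>m * (k + 1)\<^sup>2\<close> split amounts. The equations are the balances of the levels and
  sizes, and one for each coordinate that ties it to its load. The balances are needed for the
  sizes up to \<open>2 * k\<close>: sums \<open>a + b\<close> between \<open>k + 1\<close> and \<open>2 * k\<close> can occur as tails, and the balance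
  forces the amounts on them to vanish.
\<close>
lemma flow_polytope_as_system:
  "\<exists>q E F g. q \<le> (m + 1) * (2 * k + 1) + m \<and>
    E \<in> carrier_mat q m \<and> F \<in> carrier_mat q (m * (k + 1)\<^sup>2) \<and> g \<in> carrier_vec q \<and>
    {y \<in> carrier_vec m. \<exists>w \<in> carrier_vec (m * (k + 1)\<^sup>2).
      0\<^sub>v (m * (k + 1)\<^sup>2) \<le> w \<and> E *\<^sub>v y + F *\<^sub>v w = g} = flow_polytope k m"
proof -
  define V where "V = {..<m} \<times> {..k} \<times> {..k}"
  define N where "N = {(r, j). r \<le> m \<and> j \<le> 2 * k \<and> (r = 0 \<longrightarrow> 2 \<le> j)}"
  define I where "I = Inl ` N \<union> Inr ` {..<m}"
  define e :: "nat \<times> nat + nat \<Rightarrow> nat \<Rightarrow> real"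
    where "e = case_sum (\<lambda>_ _. 0) (\<lambda>c c'. of_bool (c' = c))"
  define f :: "nat \<times> nat + nat \<Rightarrow> nat \<times> nat \<times> nat \<Rightarrow> real"
    where "f = case_sum (\<lambda>(r, j). incidence r j) (\<lambda>c (r, a, b). - (of_bool (r = c) * real b))"
  define g :: "nat \<times> nat + nat \<Rightarrow> real"
    where "g = case_sum (\<lambda>(r, j). - of_bool (r = m \<and> j = k)) (\<lambda>_. 0)"
  have N_sub: "N \<subseteq> {..m} \<times> {..2 * k}" by (auto simp: N_def)
  have finN: "finite N" using N_sub by (rule finite_subset) simp
  have finI: "finite I" and finV: "finite V" using finN by (simp_all add: I_def V_def)
  have "card N \<le> (m + 1) * (2 * k + 1)"
    using card_mono[OF _ N_sub] by (simp add: card_cartesian_product)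
  then have cardI: "card I \<le> (m + 1) * (2 * k + 1) + m"
    using card_Un_le[of "Inl ` N" "Inr ` {..<m} :: (nat \<times> nat + nat) set"]
      card_image_le[OF finN, of "Inl :: _ \<Rightarrow> nat \<times> nat + nat"]
      card_image_le[of "{..<m}" "Inr :: _ \<Rightarrow> nat \<times> nat + nat"]
    by (simp add: I_def)
  have cardV: "card V = m * (k + 1)\<^sup>2"
    by (simp add: V_def card_cartesian_product power2_eq_square)
  have system_iff: "(\<forall>i\<in>I. (\<Sum>c<m. e i c * y $ c) + (\<Sum>v\<in>V. f i v * (case v of (r, a, b) \<Rightarrow> x r a b)) = g i)
      \<longleftrightarrow> flow k m (\<lambda>j. of_bool (j = k)) x \<and> (\<forall>c<m. load k x c = y $ c)"
    for y :: "real vec" and x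
  proof -
    have node: "(\<Sum>c<m. e (Inl (r, j)) c * y $ c)
          + (\<Sum>v\<in>V. f (Inl (r, j)) v * (case v of (r, a, b) \<Rightarrow> x r a b)) = g (Inl (r, j))
        \<longleftrightarrow> (if r = m then of_bool (j = k) else inflow k x r j)
          = (if r = 0 then 0 else outflow k x (r - 1) j)" if "r \<le> m" for r j
      using sum_incidence[OF that, of j x k] by (auto simp: e_def f_def g_def V_def)
    have "(\<forall>(r, j)\<in>N. (if r = m then of_bool (j = k) else inflow k x r j)
          = (if r = 0 then 0 else outflow k x (r - 1) j)) \<longleftrightarrow> flow k m (\<lambda>j. of_bool (j = k)) x"
      unfolding flow_iff_balance
    proof (intro iffI allI impI)
      fix r j :: nat assume N: "\<forall>(r, j)\<in>N. (if r = m then of_bool (j = k) else inflow k x r j)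
          = (if r = 0 then 0 else outflow k x (r - 1) j)"
        and r: "r \<le> m" and j: "r = 0 \<longrightarrow> 2 \<le> j"
      show "(if r = m then of_bool (j = k) else inflow k x r j)
          = (if r = 0 then 0 else outflow k x (r - 1) j)"
      proof (cases "j \<le> 2 * k")
        case True
        then show ?thesis using N r j unfolding N_def by blast
      next
        \<comment> \<open>No hyperarc touches such a size, so its balance reads \<open>0 = 0\<close>.\<close>
        case False
        then show ?thesis by (simp add: outflow_large inflow_eq)
      qed
    qed (auto simp: N_def)
    moreover have "(\<Sum>c'<m. e (Inr c) c' * y $ c')
          + (\<Sum>v\<in>V. f (Inr c) v * (case v of (r, a, b) \<Rightarrow> x r a b)) = g (Inr c)
        \<longleftrightarrow> load k x c = y $ c" if "c < m" for c
    proof -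
      have "(\<Sum>v\<in>V. f (Inr c) v * (case v of (r, a, b) \<Rightarrow> x r a b))
          = - (\<Sum>(r, a, b)\<in>V. of_bool (r = c) * (real b * x r a b))"
        unfolding sum_negf[symmetric] by (intro sum.cong refl) (auto simp: f_def)
      also have "\<dots> = - load k x c"
        using sum_level[OF that, of "\<lambda>_ b. real b" x k] by (simp add: V_def load_def)
      finally show ?thesis using that by (auto simp: e_def g_def Int_insert_right)
    qed
    ultimately show ?thesis
      using node unfolding I_def ball_Un ball_simps N_def by (fastforce simp: N_def)
  qed
  obtain E F h where EFh: "E \<in> carrier_mat (card I) m" "F \<in> carrier_mat (card I) (card V)"
      "h \<in> carrier_vec (card I)"
    and sol: "\<And>y. y \<in> carrier_vec m \<Longrightarrow>
      (\<exists>w \<in> carrier_vec (card V). 0\<^sub>v (card V) \<le> w \<and> E *\<^sub>v y + F *\<^sub>v w = h) \<longleftrightarrow>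
      (\<exists>x. (\<forall>v. 0 \<le> x v) \<and> (\<forall>i\<in>I. (\<Sum>c<m. e i c * y $ c) + (\<Sum>v\<in>V. f i v * x v) = g i))"
    using linear_system_as_matrices[OF finI finV, of m e f g] by blast
  have "(\<exists>w \<in> carrier_vec (card V). 0\<^sub>v (card V) \<le> w \<and> E *\<^sub>v y + F *\<^sub>v w = h) \<longleftrightarrow> y \<in> flow_polytope k m"
    if y: "y \<in> carrier_vec m" for y
    unfolding sol[OF y] flow_polytope_def
  proof (intro iffI)
    assume "\<exists>x. (\<forall>v. 0 \<le> x v) \<and> (\<forall>i\<in>I. (\<Sum>c<m. e i c * y $ c) + (\<Sum>v\<in>V. f i v * x v) = g i)"
    then obtain x where x: "\<And>v. 0 \<le> x v"
      "\<forall>i\<in>I. (\<Sum>c<m. e i c * y $ c) + (\<Sum>v\<in>V. f i v * x v) = g i" by blast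
    have "x = (\<lambda>v. case v of (r, a, b) \<Rightarrow> (\<lambda>r a b. x (r, a, b)) r a b)" by auto
    then show "y \<in> {y \<in> carrier_vec m. \<exists>x. (\<forall>r a b. 0 \<le> x r a b) \<and>
        flow k m (\<lambda>j. of_bool (j = k)) x \<and> (\<forall>c<m. load k x c = y $ c)}"
      using x y system_iff[of y "\<lambda>r a b. x (r, a, b)"]
      by (intro CollectI conjI exI[of _ "\<lambda>r a b. x (r, a, b)"]) auto
  next
    assume "y \<in> {y \<in> carrier_vec m. \<exists>x. (\<forall>r a b. 0 \<le> x r a b) \<and>
        flow k m (\<lambda>j. of_bool (j = k)) x \<and> (\<forall>c<m. load k x c = y $ c)}"
    then obtain x where x: "\<And>r a b. 0 \<le> x r a b"
      "flow k m (\<lambda>j. of_bool (j = k)) x \<and> (\<forall>c<m. load k x c = y $ c)" by blast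
    show "\<exists>x. (\<forall>v. 0 \<le> x v) \<and> (\<forall>i\<in>I. (\<Sum>c<m. e i c * y $ c) + (\<Sum>v\<in>V. f i v * x v) = g i)"
      using x(2)[folded system_iff] x(1) by (intro exI[of _ "\<lambda>(r, a, b). x r a b"]) auto
  qed
  then have "{y \<in> carrier_vec m. \<exists>w \<in> carrier_vec (card V). 0\<^sub>v (card V) \<le> w \<and> E *\<^sub>v y + F *\<^sub>v w = h}
      = flow_polytope k m"
    by (auto simp: flow_polytope_def)
  then show ?thesis using EFh cardI unfolding cardV
    by (intro exI[of _ "card I"] exI[of _ E] exI[of _ F] exI[of _ h] conjI)
qed

section \<open>The flow polytope is the convex hull\<close>

lemma convex_vec_sum:
  assumes "convex_vec m C" "finite I"
    and "\<And>i. i \<in> I \<Longrightarrow> 0 \<le> \<mu> i" "\<And>i. i \<in> I \<Longrightarrow> \<mu> i \<noteq> 0 \<Longrightarrow> v i \<in> C" "sum \<mu> I = 1"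
  shows "vec m (\<lambda>c. \<Sum>i\<in>I. \<mu> i * v i $ c) \<in> C"
  using assms(2-)
proof (induction I arbitrary: \<mu> rule: finite_induct)
  case (insert a I)
  note CC = assms(1)[unfolded convex_vec_def]
  define s where "s = sum \<mu> I"
  have s: "0 \<le> s" "\<mu> a + s = 1"
    using insert.prems insert.hyps by (auto simp: s_def intro: sum_nonneg)
  let ?goal = "vec m (\<lambda>c. \<Sum>i\<in>insert a I. \<mu> i * v i $ c)"
  show ?case
  proof (cases "s = 0")
    case True
    then have "\<mu> i = 0" if "i \<in> I" for i
      using insert.prems(1) insert.hyps(1) that sum_nonneg_eq_0_iff[of I \<mu>] by (auto simp: s_def)
    moreover have "\<mu> a = 1" using s True by simp
    moreover have a: "v a \<in> C" using insert.prems(2)[of a] \<open>\<mu> a = 1\<close> by simp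
    ultimately have "?goal = v a"
      using CC insert.hyps by (intro eq_vecI) auto
    then show ?thesis using a by simp
  next
    case False
    define p where "p = vec m (\<lambda>c. \<Sum>i\<in>I. \<mu> i / s * v i $ c)"
    have p: "p \<in> C" unfolding p_def
      using insert.prems s False by (intro insert.IH) (auto simp: s_def simp flip: sum_divide_distrib)
    have s_p: "s * (\<Sum>i\<in>I. \<mu> i * v i $ c / s) = (\<Sum>i\<in>I. \<mu> i * v i $ c)" for c
      using False by (simp add: sum_distrib_left)
    show ?thesis
    proof (cases "\<mu> a = 0")
      case True
      then have "?goal = p" using s insert.hyps by (simp add: p_def)
      then show ?thesis using p by simp
    next
      case a: False
      then have va: "v a \<in> C" using insert.prems(2) by simp
      have "?goal = \<mu> a \<cdot>\<^sub>v v a + s \<cdot>\<^sub>v p"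
        using carrier_vecD[of "v a" m] CC va insert.hyps by (intro eq_vecI) (auto simp: p_def s_p)
      moreover have "\<mu> a \<cdot>\<^sub>v v a + s \<cdot>\<^sub>v p \<in> C"
        using CC va p s insert.prems(1)[of a] by auto
      ultimately show ?thesis by simp
    qed
  qed
qed simp

lemma convex_vec_conv:
  assumes "S \<subseteq> carrier_vec m"
  shows "convex_vec m (conv m S)"
proof -
  have "convex_vec m (carrier_vec m)" by (simp add: convex_vec_def)
  then have "conv m S \<subseteq> carrier_vec m"
    unfolding conv_def using assms by (intro hull_minimal)
  moreover have "u \<cdot>\<^sub>v x + v \<cdot>\<^sub>v y \<in> conv m S"
    if xy: "x \<in> conv m S" "y \<in> conv m S" and uv: "0 \<le> u" "0 \<le> v" "u + v = 1" for x y u v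
    unfolding conv_def hull_def
  proof
    fix T assume T: "T \<in> {T. convex_vec m T \<and> S \<subseteq> T}"
    then have "x \<in> T" "y \<in> T" using xy by (auto simp: conv_def hull_def)
    then show "u \<cdot>\<^sub>v x + v \<cdot>\<^sub>v y \<in> T" using T uv by (auto simp: convex_vec_def)
  qed
  ultimately show ?thesis by (simp add: convex_vec_def)
qed

lemma convex_flow_polytope: "convex_vec m (flow_polytope k m)"
  unfolding convex_vec_def
proof (intro conjI ballI allI impI)
  fix y y' :: "real vec" and u v :: real
  assume y: "y \<in> flow_polytope k m" and y': "y' \<in> flow_polytope k m"
    and uv: "0 \<le> u" "0 \<le> v" "u + v = 1"
  have carrier: "y \<in> carrier_vec m" "y' \<in> carrier_vec m"
    using y y' by (auto simp: flow_polytope_def)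
  obtain x where x: "\<And>r a b. 0 \<le> x r a b" "flow k m (\<lambda>j. of_bool (j = k)) x"
      "\<And>c. c < m \<Longrightarrow> load k x c = y $ c" using y by (auto simp: flow_polytope_def)
  obtain x' where x': "\<And>r a b. 0 \<le> x' r a b" "flow k m (\<lambda>j. of_bool (j = k)) x'"
      "\<And>c. c < m \<Longrightarrow> load k x' c = y' $ c" using y' by (auto simp: flow_polytope_def)
  let ?x = "\<lambda>r a b. u * x r a b + v * x' r a b"
  have "flow k m (\<lambda>j. of_bool (j = k)) ?x"
    using flow_linear_combination[OF x(2) x'(2), of u v] uv(3) by (simp flip: distrib_right)
  moreover have "load k ?x c = (u \<cdot>\<^sub>v y + v \<cdot>\<^sub>v y') $ c" if "c < m" for c
    using that carrier y y' by (simp add: load_lin x(3) x'(3))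
  moreover have "0 \<le> ?x r a b" for r a b using uv x(1) x'(1) by simp
  ultimately show "u \<cdot>\<^sub>v y + v \<cdot>\<^sub>v y' \<in> flow_polytope k m"
    using carrier unfolding flow_polytope_def by (intro CollectI conjI exI[of _ ?x]) auto
qed (auto simp: flow_polytope_def)

text \<open>
  Flows of families give one inclusion, since the flow polytope is convex. For the other one the
  supply is one unit of the size \<open>k\<close>, so the weights of a decomposition are supported on families of
  \<open>k\<close> sets and sum up to 1: they are the coefficients of a convex combination.
\<close>
lemma flow_polytope_eq_conv: "flow_polytope k m = conv m (map_vec real ` Y k m)"
proof
  show "conv m (map_vec real ` Y k m) \<subseteq> flow_polytope k m"
    unfolding conv_def
  proof (rule hull_minimal[where S = "convex_vec m"], rule image_subsetI)
    fix y assume "y \<in> Y k m"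
    then obtain A where y: "y \<in> carrier_vec m" and A: "A \<in> families m" "card A = k"
      and deg: "\<And>c. c < m \<Longrightarrow> y $ c = deg c A" by (auto simp: Y_iff_family)
    from flow_of_family[OF A(1), of k] A(2) y deg show "map_vec real y \<in> flow_polytope k m"
      by (auto simp: flow_polytope_def)
  qed (rule convex_flow_polytope)
  show "flow_polytope k m \<subseteq> conv m (map_vec real ` Y k m)"
  proof
    fix y assume "y \<in> flow_polytope k m"
    then obtain x where y: "y \<in> carrier_vec m" and x: "\<And>r a b. 0 \<le> x r a b"
        "flow k m (\<lambda>j. of_bool (j = k)) x" "\<And>c. c < m \<Longrightarrow> load k x c = y $ c"
      by (auto simp: flow_polytope_def)
    obtain \<mu> where \<mu>: "\<And>A. 0 \<le> \<mu> A"
        "\<And>j. (\<Sum>A\<in>families m. of_bool (card A = j) * \<mu> A) = of_bool (j = k)"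
        "\<And>c. c < m \<Longrightarrow> (\<Sum>A\<in>families m. \<mu> A * real (deg c A)) = load k x c"
      using flow_decomposition[OF x(1,2)] by auto
    have card_k: "card A = k" if "A \<in> families m" "\<mu> A \<noteq> 0" for A
    proof (rule ccontr)
      assume "card A \<noteq> k"
      then have "(\<Sum>B\<in>families m. of_bool (card B = card A) * \<mu> B) = 0" by (simp add: \<mu>(2))
      then have "of_bool (card A = card A) * \<mu> A = 0"
        using \<mu>(1) that(1) by (subst (asm) sum_nonneg_eq_0_iff) auto
      then show False using that(2) by simp
    qed
    have "sum \<mu> (families m) = (\<Sum>A\<in>families m. of_bool (card A = k) * \<mu> A)"
      using card_k by (intro sum.cong refl) auto
    then have total: "sum \<mu> (families m) = 1" using \<mu>(2)[of k] by simp
    define v where "v A = map_vec real (vec m (\<lambda>c. deg c A))" for A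
    have sub: "map_vec real ` Y k m \<subseteq> carrier_vec m" by (auto simp: Y_def)
    have "v A \<in> conv m (map_vec real ` Y k m)" if "A \<in> families m" "\<mu> A \<noteq> 0" for A
    proof -
      have "vec m (\<lambda>c. deg c A) \<in> Y k m"
        using that card_k[OF that] by (auto simp: Y_iff_family)
      then show ?thesis unfolding conv_def v_def by (intro hull_inc imageI)
    qed
    then have "vec m (\<lambda>c. \<Sum>A\<in>families m. \<mu> A * v A $ c) \<in> conv m (map_vec real ` Y k m)"
      using convex_vec_conv[OF sub] \<mu>(1) total by (intro convex_vec_sum) auto
    moreover have "vec m (\<lambda>c. \<Sum>A\<in>families m. \<mu> A * v A $ c) = y"
      using y by (intro eq_vecI) (auto simp: v_def \<mu>(3) x(3))
    ultimately show "y \<in> conv m (map_vec real ` Y k m)" by simp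
  qed
qed

theorem theorem1:
  shows "\<exists>C :: nat. \<forall>k m :: nat. k \<ge> 1 \<longrightarrow> m \<ge> 1 \<longrightarrow>
    (\<exists>p q :: nat. \<exists>E F :: real mat. \<exists>g :: real vec.
       E \<in> carrier_mat q m \<and> F \<in> carrier_mat q p \<and> g \<in> carrier_vec q \<and>
       m + p \<le> C * (k\<^sup>2 * m) \<and>
       q + p \<le> C * (k\<^sup>2 * m) \<and>
       {y \<in> carrier_vec m. \<exists>w \<in> carrier_vec p. 0\<^sub>v p \<le> w \<and> E *\<^sub>v y + F *\<^sub>v w = g}
         = conv m (map_vec real ` Y k m))"
proof (rule exI[of _ 11], intro allI impI)
  fix k m :: nat
  assume k: "k \<ge> 1" and m: "m \<ge> 1"
  have sq: "k \<le> k\<^sup>2" "1 \<le> k\<^sup>2" using k by (simp_all add: power2_eq_square)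
  have "(k + 1)\<^sup>2 = k\<^sup>2 + 2 * k + 1" by (simp add: power2_eq_square)
  then have "(k + 1)\<^sup>2 \<le> 4 * k\<^sup>2" using sq by linarith
  then have p: "m * (k + 1)\<^sup>2 \<le> 4 * (k\<^sup>2 * m)" by (simp add: mult.commute mult_le_mono)
  have "(m + 1) * (2 * k + 1) \<le> (2 * m) * (3 * k\<^sup>2)"
    using m k sq by (intro mult_le_mono) linarith+
  then have q: "(m + 1) * (2 * k + 1) \<le> 6 * (k\<^sup>2 * m)" by (simp add: mult_ac)
  have one: "m \<le> k\<^sup>2 * m" using sq(2) by simp
  obtain E F g q where "q \<le> (m + 1) * (2 * k + 1) + m"
    "E \<in> carrier_mat q m" "F \<in> carrier_mat q (m * (k + 1)\<^sup>2)" "g \<in> carrier_vec q"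
    "{y \<in> carrier_vec m. \<exists>w \<in> carrier_vec (m * (k + 1)\<^sup>2).
        0\<^sub>v (m * (k + 1)\<^sup>2) \<le> w \<and> E *\<^sub>v y + F *\<^sub>v w = g} = conv m (map_vec real ` Y k m)"
    using flow_polytope_as_system[of m k] unfolding flow_polytope_eq_conv by blast
  moreover from this(1) p q one
  have "m + m * (k + 1)\<^sup>2 \<le> 11 * (k\<^sup>2 * m)" "q + m * (k + 1)\<^sup>2 \<le> 11 * (k\<^sup>2 * m)"
    by linarith+
  ultimately show "\<exists>p q E F g. E \<in> carrier_mat q m \<and> F \<in> carrier_mat q p \<and> g \<in> carrier_vec q \<and>
      m + p \<le> 11 * (k\<^sup>2 * m) \<and> q + p \<le> 11 * (k\<^sup>2 * m) \<and>
      {y \<in> carrier_vec m. \<exists>w \<in> carrier_vec p. 0\<^sub>v p \<le> w \<and> E *\<^sub>v y + F *\<^sub>v w = g}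
        = conv m (map_vec real ` Y k m)"
    by blast
qed

end
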